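(* Let $R>0$, $N>1$, and let $g\colon[a,b]\to\mathbb{R}^2$ be an injective $R$-path. For $x=g(t)$, $t\in[a,b]$, put $g_x=g([a,t])$. Assume that for every $x\in g([a,b])$, $g_x\subset D\left(x,\frac{R}{N}\right)$. Then for every $x\in g([a,b])$, $$\mathrm{meas}\big(\mathrm{Tan}(\mathrm{co}(g_x),x)\cap\mathbb{S}^1\big)\le\frac{\pi}{2}+2\arcsin\left(\frac{1}{2N}\right).$$
   Context: Notation: $B(z,\rho)$ is the open disk in $\mathbb{R}^2$ of center $z$ and radius $\rho$, $D(z,\rho)$ its closure, $\mathbb{S}^1$ the unit circle, $\mathrm{co}(S)$ the convex hull of $S$, and $\mathrm{meas}$ is the arc length measure on $\mathbb{S}^1$. For a nonempty closed set $K\subset\mathbb{R}^2$ and $q\in K$, the tangent cone is $$\mathrm{Tan}(K,q)=\{v\in\mathbb{R}^2:\forall\varepsilon>0\ \exists x\in K,\ r>0\text{ with }|x-q|<\varepsilon,\ |r(x-q)-v|<\varepsilon\}.$$ $R$-path: let $R>0$. A continuous map $g\colon[a,b]\to\mathbb{R}^2$ with $g(a)\ne g(b)$ is an $R$-path if for every $t\in[a,b]$, writing $x=g(t)$, and for every unit vector $l\in\big[-\mathrm{Tan}(g([a,t]),x)\big]\cup\mathrm{Tan}(g([t,b]),x)$, one has $g([a,t])\cap B(x+Rl,R)=\varnothing$. *)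

theory Defs
  imports "HOL-Analysis.Analysis"
begin

definition tangent_cone :: "(real^2) set \<Rightarrow> real^2 \<Rightarrow> (real^2) set" where
  "tangent_cone K q =
     {v. \<forall>\<epsilon>>0. \<exists>x\<in>K. \<exists>r>0. norm (x - q) < \<epsilon> \<and> norm (r *\<^sub>R (x - q) - v) < \<epsilon>}"

text \<open>The order \<open>a \<le> b\<close> is part of the notation \<open>[a,b]\<close>; together with
  \<open>g a \<noteq> g b\<close> it gives \<open>a < b\<close>.\<close>

definition R_path :: "real \<Rightarrow> real \<Rightarrow> real \<Rightarrow> (real \<Rightarrow> real^2) \<Rightarrow> bool" where
  "R_path R a b g \<longleftrightarrow>
     R > 0 \<and> a \<le> b \<and> continuous_on {a..b} g \<and> g a \<noteq> g b \<and>
     (\<forall>t\<in>{a..b}. \<forall>l. norm l = 1 \<longrightarrow>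
        l \<in> uminus ` tangent_cone (g ` {a..t}) (g t) \<union> tangent_cone (g ` {t..b}) (g t) \<longrightarrow>
        g ` {a..t} \<inter> ball (g t + R *\<^sub>R l) R = {})"

definition circle_point :: "real \<Rightarrow> real^2" where
  "circle_point \<theta> = vector [cos \<theta>, sin \<theta>]"

text \<open>Arc length on the unit circle, as a Borel measure with space \<open>sphere 0 1\<close>: the image of
  Lebesgue measure on \<open>[0, 2\<pi>)\<close> under the bijective unit speed parametrisation
  \<open>circle_point\<close>.\<close>

definition arc_length_measure :: "(real^2) measure" where
  "arc_length_measure =
     distr (restrict_space lborel {0..<2*pi}) (restrict_space borel (sphere 0 1)) circle_point"

text \<open>The following facts rule out default values: the parametrisation is measurable, the total
  mass is \<open>2\<pi>\<close>, and the trace of a tangent cone on the circle is a measurable set.\<close>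

lemma circle_point_measurable:
  "circle_point \<in> restrict_space lborel {0..<2*pi} \<rightarrow>\<^sub>M restrict_space borel (sphere 0 1)"
proof -
  have eq: "circle_point = (\<lambda>t. cos t *\<^sub>R axis 1 1 + sin t *\<^sub>R axis 2 1)"
    by (simp add: circle_point_def fun_eq_iff vec_eq_iff forall_2 axis_def)
  have "continuous_on UNIV circle_point"
    by (subst eq) (intro continuous_intros)
  then have "circle_point \<in> borel_measurable lborel"
    by (simp add: borel_measurable_continuous_onI)
  moreover have "norm (circle_point t) = 1" for t
    by (simp add: circle_point_def norm_vec_def L2_set_def sum_2)
  ultimately show ?thesis
    by (intro measurable_restrict_space2 measurable_restrict_space1) auto
qed

lemma measure_arc_length_total: "measure arc_length_measure (sphere 0 1) = 2 * pi"
proof -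
  have s: "sphere 0 1 \<in> sets (restrict_space borel (sphere 0 (1::real) :: (real^2) set))"
    by (simp add: sets_restrict_space_iff)
  have "circle_point -` sphere 0 1 \<inter> space (restrict_space lborel {0..<2*pi}) = {0..<2*pi}"
    using measurable_space[OF circle_point_measurable]
    by (auto simp: space_restrict_space)
  then show ?thesis
    unfolding arc_length_measure_def measure_distr[OF circle_point_measurable s]
    by (simp add: measure_restrict_space)
qed

lemma closed_tangent_cone: "closed (tangent_cone K q)"
  unfolding closed_sequential_limits
proof safe
  fix f v assume f: "\<forall>n. f n \<in> tangent_cone K q" and lim: "f \<longlonglongrightarrow> v"
  show "v \<in> tangent_cone K q"
    unfolding tangent_cone_def
  proof safe
    fix e :: real assume e: "e > 0"
    obtain n where n: "norm (f n - v) < e / 2"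
      using LIMSEQ_D[OF lim half_gt_zero[OF e]] by blast
    obtain x r where xr: "x \<in> K" "r > 0" "norm (x - q) < e / 2" "norm (r *\<^sub>R (x - q) - f n) < e / 2"
    proof -
      have "\<forall>\<epsilon>>0. \<exists>x\<in>K. \<exists>r>0. norm (x - q) < \<epsilon> \<and> norm (r *\<^sub>R (x - q) - f n) < \<epsilon>"
        using f unfolding tangent_cone_def by blast
      moreover have "e / 2 > 0" using e by simp
      ultimately show ?thesis using that by blast
    qed
    have "norm (r *\<^sub>R (x - q) - v) < e"
      using norm_triangle_ineq[of "r *\<^sub>R (x - q) - f n" "f n - v"] n xr by simp
    then show "\<exists>x\<in>K. \<exists>r>0. norm (x - q) < e \<and> norm (r *\<^sub>R (x - q) - v) < e"
      using xr e by (intro bexI[of _ x] exI[of _ r]) auto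
  qed
qed

lemma tangent_cone_sphere_measurable: "tangent_cone K q \<inter> sphere 0 1 \<in> sets arc_length_measure"
  by (simp add: arc_length_measure_def sets_restrict_space_iff borel_closed closed_Int closed_tangent_cone)

end

theory Submission
  imports Defs
begin

text \<open>Put \<open>\<sigma> = 1 / (2 * N)\<close>, \<open>y = g r\<close>, \<open>z = g s\<close> with \<open>r < s\<close>, and let the point \<open>x\<close> follow the path
  from \<open>z\<close> onwards. The ball condition together with \<open>norm (y - x) \<le> R / N\<close> says that a forward unit
  tangent \<open>l\<close> at \<open>x\<close> has inner product at most \<open>\<sigma>\<close> with the unit vectors towards \<open>y\<close> and \<open>z\<close>. Hence,
  whenever the angle \<open>y x z\<close> equals some \<open>c\<close> strictly between \<open>pi / 2 + arcsin \<sigma>\<close> and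
  \<open>pi - 2 * arcsin \<sigma>\<close> (an interval that is nonempty exactly because \<open>N > 1\<close>), it is strictly
  decreasing to the right; it also starts below \<open>c\<close> at \<open>x = z\<close>, so it never exceeds \<open>c\<close>.
  Thus any two points of the past of \<open>x\<close> are seen from \<open>x\<close> under an angle at most
  \<open>pi / 2 + arcsin \<sigma>\<close>. As this is less than \<open>2 * pi / 3\<close>, all directions lie in a single arc of that
  length (three directions cannot be pairwise that close while surrounding \<open>x\<close>), and the cone over
  this arc contains the tangent cone of the convex hull. The resulting bound
  \<open>pi / 2 + arcsin \<sigma>\<close> is slightly better than the one claimed.\<close>

section \<open>Plane geometry of the angle under a forward motion\<close>

text \<open>Three vectors of the plane are linearly dependent, so their Gram determinant vanishes;
  this is that determinant expanded.\<close>

lemma gram_identity_2: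
  fixes l p q :: "real^2"
  shows "(l \<bullet> l) * (p \<bullet> p) * (q \<bullet> q) + 2 * (l \<bullet> p) * (l \<bullet> q) * (p \<bullet> q)
    = (l \<bullet> l) * (p \<bullet> q)^2 + (p \<bullet> p) * (l \<bullet> q)^2 + (q \<bullet> q) * (l \<bullet> p)^2"
  by (simp add: inner_vec_def sum_2 power2_eq_square algebra_simps)

text \<open>Since \<open>-1 < k < 0\<close>, the constraints describe a triangle (a point if
  \<open>s = 0\<close>) and the form is convex. Completing the square about \<open>Q = k * P\<close>
  shows that raising \<open>Q\<close> to \<open>s\<close> does not decrease the form. This leaves
  the side \<open>Q = s\<close>: its end \<open>P = s\<close> uses \<open>2 * s^2 - 1 < k\<close>,
  its end \<open>P = s / k\<close> uses \<open>k < - s\<close>.\<close>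

lemma quadratic_form_less_on_triangle:
  fixes k s P Q :: real
  assumes s: "0 \<le> s" and k: "2 * s^2 - 1 < k" "k < - s"
    and P: "P \<le> s" and Q: "Q \<le> s" and PQ: "k * P \<le> Q"
  shows "P^2 + Q^2 - 2 * k * P * Q < 1 - k^2"
proof -
  have k0: "k < 0" and "k > -1" using s k zero_le_power2[of s] by linarith+
  then have k1: "0 < 1 + k" "0 < 1 - k" by auto
  then have k2: "0 < 1 - k^2"
    using mult_pos_pos[OF k1] by (simp add: algebra_simps power2_eq_square)
  have kk: "0 < k^2" using k0 by simp
  have sk: "s^2 < k^2" using s k abs_le_square_iff[of k s] by auto
  have eq1: "P^2 + Q^2 - 2 * k * P * Q = (Q - k * P)^2 + (1 - k^2) * P^2"
    by (simp add: power2_eq_square algebra_simps)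
  have up: "(Q - k * P)^2 \<le> (s - k * P)^2"
    using Q PQ by (intro power_mono) auto
  have Pl: "s / k \<le> P"
    using k0 Q PQ by (simp add: divide_le_eq mult.commute)
  define h where "h = (\<lambda>x::real. (s - k * x)^2 + (1 - k^2) * x^2)"
  have hh: "h x = s^2 - 2 * k * s * x + x^2" for x
    by (simp add: h_def power2_eq_square algebra_simps)
  have hs: "h s < 1 - k^2"
  proof -
    have "h s = 2 * s^2 * (1 - k)" unfolding hh by (simp add: power2_eq_square algebra_simps)
    also have "\<dots> < (1 + k) * (1 - k)" using k k1 by (intro mult_strict_right_mono) auto
    finally show ?thesis by (simp add: power2_eq_square algebra_simps)
  qed
  have hl: "h (s / k) < 1 - k^2"
  proof -
    have "h (s / k) = (1 - k^2) * (s^2 / k^2)"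
      unfolding h_def using k0 by (simp add: power_divide)
    also have "\<dots> < (1 - k^2) * 1"
      using k2 kk sk by (intro mult_strict_left_mono) auto
    finally show ?thesis by simp
  qed
  \<comment> \<open>\<open>h\<close> is convex, so its maximum over \<open>[s / k, s]\<close> is attained at an endpoint.\<close>
  have hP: "h P < 1 - k^2"
  proof -
    have "(s - s / k) * h P \<le> (P - s / k) * h s + (s - P) * h (s / k)"
    proof -
      have "(P - w) * h s + (s - P) * h w - (s - w) * h P = (s - w) * ((P - w) * (s - P))" for w
        unfolding hh by (simp add: power2_eq_square algebra_simps)
      from this[of "s / k"]
      have "(P - s / k) * h s + (s - P) * h (s / k) - (s - s / k) * h P
        = (s - s/k) * ((P - s / k) * (s - P))" .
      moreover have "0 \<le> s - s / k" using s k0 Pl P by linarith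
      then have "0 \<le> (s - s / k) * ((P - s / k) * (s - P))"
        using Pl P by (intro mult_nonneg_nonneg) auto
      ultimately show ?thesis by linarith
    qed
    show ?thesis
    proof (cases "s / k = s")
      case True
      then have "P = s" using P Pl by simp
      then show ?thesis using hs by simp
    next
      case False
      then have pos: "0 < s - s / k" using P Pl by linarith
      have "(P - s / k) * h s + (s - P) * h (s / k) \<le> (s - s/k) * max (h s) (h (s/k))"
      proof -
        have "(P - s / k) * h s \<le> (P - s / k) * max (h s) (h (s/k))"
          using Pl by (intro mult_left_mono) auto
        moreover have "(s - P) * h (s / k) \<le> (s - P) * max (h s) (h (s/k))"
          using P by (intro mult_left_mono) auto
        ultimately show ?thesis by (simp add: algebra_simps)
      qed
      then have "(s - s / k) * h P \<le> (s - s/k) * max (h s) (h (s/k))"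
        using \<open>(s - s / k) * h P \<le> (P - s / k) * h s + (s - P) * h (s / k)\<close> by linarith
      then have "h P \<le> max (h s) (h (s/k))" using pos by simp
      then show ?thesis using hs hl by auto
    qed
  qed
  show ?thesis using hP up eq1 unfolding h_def by linarith
qed

text \<open>For unit vectors the Gram identity makes the quadratic form of
  \<open>l \<bullet> p\<close> and \<open>l \<bullet> q\<close> equal to
  \<open>1 - (p \<bullet> q)^2\<close>. The strict bound on the triangle is thus violated, so the
  one remaining constraint must fail.\<close>

lemma inner_less_of_gram:
  fixes l p q :: "real^2"
  assumes "norm l = 1" "norm p = 1" "norm q = 1" and s: "0 \<le> s"
    and k: "2 * s^2 - 1 < p \<bullet> q" "p \<bullet> q < - s"
    and "l \<bullet> p \<le> s" "l \<bullet> q \<le> s"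
  shows "l \<bullet> q < (p \<bullet> q) * (l \<bullet> p)"
proof (rule ccontr)
  assume "\<not> ?thesis"
  then have "(l \<bullet> p)^2 + (l \<bullet> q)^2 - 2 * (p \<bullet> q) * (l \<bullet> p) * (l \<bullet> q) < 1 - (p \<bullet> q)^2"
    using assms by (intro quadratic_form_less_on_triangle) auto
  moreover have "l \<bullet> l = 1" "p \<bullet> p = 1" "q \<bullet> q = 1"
    using assms by (simp_all add: dot_square_norm)
  ultimately show False
    using gram_identity_2[of l p q] by (simp add: algebra_simps)
qed

text \<open>For \<open>p = y - x\<close> and \<open>q = z - x\<close> the expression is the
  derivative in \<open>x\<close>, along \<open>l\<close>, of \<open>(y - x) \<bullet> (z - x) - k *
  (norm (y - x) * norm (z - x))\<close>. It equals
  \<open>norm q * (k * P - Q) + norm p * (k * Q - P)\<close>, and both brackets are positive by the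
  previous lemma, used in both orders.\<close>

lemma directional_derivative_pos:
  fixes l p q :: "real^2"
  assumes l: "norm l = 1" and p: "p \<noteq> 0" and q: "q \<noteq> 0" and s: "0 \<le> s"
    and k: "2 * s^2 - 1 < k" "k < - s" and pq: "p \<bullet> q = k * (norm p * norm q)"
    and lp: "l \<bullet> p \<le> s * norm p" and lq: "l \<bullet> q \<le> s * norm q"
  shows "0 < k * (norm p * (l \<bullet> sgn q) + norm q * (l \<bullet> sgn p)) - (l \<bullet> q + l \<bullet> p)"
proof -
  define P Q where "P = l \<bullet> sgn p" and "Q = l \<bullet> sgn q"
  have n: "norm (sgn p) = 1" "norm (sgn q) = 1" using p q by (auto simp: norm_sgn)
  have np: "norm p > 0" "norm q > 0" using p q by auto
  have k': "sgn p \<bullet> sgn q = k"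
    using p q pq by (simp add: sgn_div_norm field_simps)
  have PQ: "P \<le> s" "Q \<le> s"
    using np lp lq by (simp_all add: P_def Q_def sgn_div_norm field_simps)
  have lpq: "l \<bullet> p = P * norm p" "l \<bullet> q = Q * norm q"
    using np by (simp_all add: P_def Q_def sgn_div_norm)
  have "Q < k * P"
    using inner_less_of_gram[of l "sgn p" "sgn q" s] l n s k k' PQ by (simp add: P_def Q_def)
  moreover have "P < k * Q"
    using inner_less_of_gram[of l "sgn q" "sgn p" s] l n s k k' PQ
    by (simp add: P_def Q_def inner_commute)
  ultimately have "0 < norm q * (k * P - Q) + norm p * (k * Q - P)"
    using np by (intro add_pos_pos mult_pos_pos) auto
  then show ?thesis unfolding lpq
    unfolding P_def[symmetric] Q_def[symmetric] by (simp add: algebra_simps)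
qed

section \<open>From the ball condition to angles along the path\<close>

lemma inner_le_if_notin_ball:
  fixes x y l :: "'a::real_inner"
  assumes "R > 0" "norm l = 1" "y \<notin> ball (x + R *\<^sub>R l) R"
  shows "2 * R * (l \<bullet> (y - x)) \<le> (norm (y - x))^2"
proof -
  have "R \<le> norm ((y - x) - R *\<^sub>R l)"
    using assms by (simp add: dist_norm norm_minus_commute algebra_simps)
  then have "R^2 \<le> (norm ((y - x) - R *\<^sub>R l))^2"
    using assms by (intro power_mono) auto
  also have "\<dots> = (norm (y - x))^2 - 2 * R * (l \<bullet> (y - x)) + R^2 * (l \<bullet> l)"
    unfolding power2_norm_eq_inner inner_diff_left[of "y - x"] inner_diff_right[of _ "y - x"]
    by (simp add: inner_commute power2_eq_square)
  also have "l \<bullet> l = 1"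
    using \<open>norm l = 1\<close> by (simp add: dot_square_norm)
  finally show ?thesis by simp
qed

text \<open>If \<open>P\<close> failed at path points arbitrarily close after \<open>g u\<close>,
  compactness of the circle would make their directions from \<open>g u\<close> subconverge to a
  forward unit tangent \<open>l\<close>. The premise \<open>neg\<close> is what refutes such a
  sequence.\<close>

lemma right_local_tangent:
  fixes g :: "real \<Rightarrow> real^2"
  assumes cont: "continuous_on {u..b} g" and inj: "inj_on g {u..b}" and "u < b"
    and neg: "\<And>l X. \<lbrakk>norm l = 1; l \<in> tangent_cone (g ` {u..b}) (g u); \<And>n. X n \<noteq> g u;
      X \<longlonglongrightarrow> g u; (\<lambda>n. sgn (X n - g u)) \<longlonglongrightarrow> l; \<And>n. X n \<in> g ` {u..b}; \<And>n. \<not> P (X n)\<rbrakk> \<Longrightarrow> False"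
  shows "\<exists>d>0. \<forall>v\<in>{u<..b}. v < u + d \<longrightarrow> P (g v)"
proof (rule ccontr)
  assume *: "\<not> ?thesis"
  have "\<exists>v\<in>{u<..b}. v < u + inverse (Suc n) \<and> \<not> P (g v)" for n
    using * by (metis inverse_positive_iff_positive of_nat_0_less_iff zero_less_Suc)
  then obtain v where v: "\<And>n. v n \<in> {u<..b}" "\<And>n. v n < u + inverse (Suc n)" "\<And>n. \<not> P (g (v n))"
    by metis
  have lim: "v \<longlonglongrightarrow> u"
  proof (rule tendsto_sandwich[of "\<lambda>n. u" v _ "\<lambda>n. u + inverse (real (Suc n))"])
    show "(\<lambda>n. u + inverse (real (Suc n))) \<longlonglongrightarrow> u"
      using LIMSEQ_inverse_real_of_nat_add by blast
    show "(\<lambda>n. u) \<longlonglongrightarrow> u" by simp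
    show "\<forall>\<^sub>F n in sequentially. u \<le> v n"
      using v(1) by (auto intro!: always_eventually less_imp_le)
    show "\<forall>\<^sub>F n in sequentially. v n \<le> u + inverse (real (Suc n))"
      using v(2) by (auto intro!: always_eventually less_imp_le)
  qed
  have glim: "(\<lambda>n. g (v n)) \<longlonglongrightarrow> g u"
    using continuous_on_tendsto_compose[OF cont lim] v(1) \<open>u < b\<close>
    by (auto intro!: always_eventually less_imp_le)
  have ne: "g (v n) \<noteq> g u" for n
    using inj_onD[OF inj, of "v n" u] v(1)[of n] \<open>u < b\<close> by auto
  have "\<forall>n. sgn (g (v n) - g u) \<in> sphere 0 1"
    using ne by (auto simp: norm_sgn)
  then obtain l r where l: "l \<in> sphere 0 1" and r: "strict_mono r"
    and lr: "((\<lambda>n. sgn (g (v n) - g u)) \<circ> r) \<longlonglongrightarrow> l"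
    using compact_sphere[of "0::real^2" 1, unfolded compact_def] by metis
  have glr: "(\<lambda>n. g (v (r n))) \<longlonglongrightarrow> g u"
    using LIMSEQ_subseq_LIMSEQ[OF glim r] by (simp add: o_def)
  have "l \<in> tangent_cone (g ` {u..b}) (g u)"
    unfolding tangent_cone_def
  proof safe
    fix e :: real assume "e > 0"
    then have "\<forall>\<^sub>F n in sequentially. dist (g (v (r n))) (g u) < e \<and> dist (sgn (g (v (r n)) - g u)) l < e"
      using glr lr by (intro eventually_conj) (auto simp: tendsto_iff o_def)
    then obtain n where n: "dist (g (v (r n))) (g u) < e" "dist (sgn (g (v (r n)) - g u)) l < e"
      by (auto simp: eventually_sequentially)
    show "\<exists>x\<in>g ` {u..b}. \<exists>r>0. norm (x - g u) < e \<and> norm (r *\<^sub>R (x - g u) - l) < e"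
      using n v(1)[of "r n"] ne[of "r n"]
      by (intro bexI[of _ "g (v (r n))"] exI[of _ "inverse (norm (g (v (r n)) - g u))"])
        (auto simp: dist_norm sgn_div_norm)
  qed
  then show False
    using neg[of l "\<lambda>n. g (v (r n))"] l ne glr lr v
    by (auto simp: o_def less_imp_le)
qed


text \<open>With \<open>k = cos c\<close>, the condition \<open>0 \<le> F x\<close> says that the angle \<open>y x z\<close> is at most \<open>c\<close>; this form
  stays meaningful at the starting point \<open>x = z\<close>.\<close>

lemma angle_function_right_nonneg:
  fixes g :: "real \<Rightarrow> real^2" and y z :: "real^2" and k s b :: real
  defines "F \<equiv> \<lambda>x. (y - x) \<bullet> (z - x) - k * (norm (y - x) * norm (z - x))"
  assumes cont: "continuous_on {u..b} g" and inj: "inj_on g {u..b}" and "u < b"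
    and s: "0 \<le> s" and k: "2 * s^2 - 1 < k" "k < - s"
    and y: "y \<noteq> g u" and F: "0 \<le> F (g u)"
    and tan: "\<And>l. norm l = 1 \<Longrightarrow> l \<in> tangent_cone (g ` {u..b}) (g u) \<Longrightarrow>
      l \<bullet> (y - g u) \<le> s * norm (y - g u) \<and> l \<bullet> (z - g u) \<le> s * norm (z - g u)"
  shows "\<exists>d>0. \<forall>v\<in>{u<..b}. v < u + d \<longrightarrow> 0 \<le> F (g v)"
proof (rule right_local_tangent[OF cont inj \<open>u < b\<close>])
  fix l X
  assume l: "norm l = 1" "l \<in> tangent_cone (g ` {u..b}) (g u)"
    and Xne: "\<And>n. X n \<noteq> g u" and X: "X \<longlonglongrightarrow> g u" and Xl: "(\<lambda>n. sgn (X n - g u)) \<longlonglongrightarrow> l"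
    and neg: "\<And>n::nat. \<not> 0 \<le> F (X n)"
  define x where "x = g u"
  note [folded x_def, simp] = Xne
  note X = X[folded x_def] and Xl = Xl[folded x_def] and F = F[folded x_def] and y = y[folded x_def]
  have lp: "l \<bullet> (y - x) \<le> s * norm (y - x)" and lq: "l \<bullet> (z - x) \<le> s * norm (z - x)"
    using tan[OF l] by (simp_all add: x_def)
  have Fx: "F x = 0"
  proof -
    have "(\<lambda>n. F (X n)) \<longlonglongrightarrow> F x"
      unfolding F_def by (intro tendsto_intros X)
    then have "F x \<le> 0"
      using neg by (intro LIMSEQ_le_const2[of "\<lambda>n. F (X n)"]) (auto intro!: exI[of _ 0] simp: less_imp_le not_le)
    then show ?thesis using F by simp
  qed
  show False
  proof (cases "z = x")
    case True
    \<comment> \<open>The factor \<open>norm (z - x)\<close> is not differentiable at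
      \<open>x = z\<close>, so \<open>F (X n)\<close> is divided by \<open>norm (X n - x)\<close>
      directly. The quotients are at most 0, but their limit is at least
      \<open>(- s - k) * norm (y - x) > 0\<close>.\<close>
    have "(\<lambda>n. - ((y - X n) \<bullet> sgn (X n - x)) - k * norm (y - X n)) \<longlonglongrightarrow> - ((y - x) \<bullet> l) - k * norm (y - x)"
      by (intro tendsto_intros X Xl)
    moreover have "- ((y - X n) \<bullet> sgn (X n - x)) - k * norm (y - X n) \<le> 0" for n
    proof -
      have "(- ((y - X n) \<bullet> sgn (X n - x)) - k * norm (y - X n)) * norm (X n - x) = F (X n)"
      proof -
        have "x - X n = - (norm (X n - x) *\<^sub>R sgn (X n - x))"
          by (simp add: sgn_div_norm)
        then have "(y - X n) \<bullet> (x - X n) = - (norm (X n - x) * ((y - X n) \<bullet> sgn (X n - x)))"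
          by (metis inner_minus_right inner_scaleR_right)
        then show ?thesis
          by (simp add: F_def True norm_minus_commute[of x] algebra_simps)
      qed
      then show ?thesis
        using neg[of n] by (metis Xne norm_ge_zero mult_nonneg_nonneg linear)
    qed
    ultimately have "- ((y - x) \<bullet> l) - k * norm (y - x) \<le> 0"
      by (intro LIMSEQ_le_const2) auto
    moreover have "(- s - k) * norm (y - x) > 0"
      using y k by simp
    ultimately show False
      using lp by (simp add: algebra_simps inner_commute)
  next
    case False
    \<comment> \<open>Away from \<open>y\<close> and \<open>z\<close> the function \<open>F\<close>
      is differentiable. As \<open>F x = 0\<close>, the quotients
      \<open>F (X n) / norm (X n - x)\<close> tend to \<open>F' l\<close>; they are at most 0,
      whereas \<open>F' l\<close> is positive.\<close>
    define F' where "F' = (\<lambda>h. k * (norm (y - x) * (h \<bullet> sgn (z - x)) + norm (z - x) * (h \<bullet> sgn (y - x)))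
      - (h \<bullet> (z - x) + h \<bullet> (y - x)))"
    have norm_deriv: "((\<lambda>x. norm (w - x)) has_derivative (\<lambda>h. (- h) \<bullet> sgn (w - x))) (at x)"
      if "w \<noteq> x" for w
    proof -
      have "((\<lambda>x. w - x) has_derivative (\<lambda>h. - h)) (at x)"
        by (auto intro!: derivative_eq_intros)
      from has_derivative_compose[OF this has_derivative_norm] show ?thesis
        using that by simp
    qed
    have "(F has_derivative F') (at x)"
      unfolding F_def F'_def using False y
      by (auto intro!: derivative_eq_intros norm_deriv simp: algebra_simps inner_commute)
    then have F': "(\<lambda>w. (F w - F x - F' (w - x)) /\<^sub>R norm (w - x)) \<midarrow>x\<rightarrow> 0"
      and lin: "bounded_linear F'"
      unfolding has_derivative_at_within by (auto simp: has_derivative_def)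
    have "(\<lambda>n. (F (X n) - F x - F' (X n - x)) /\<^sub>R norm (X n - x)) \<longlonglongrightarrow> 0"
      by (rule filterlim_compose[OF F']) (auto simp: filterlim_at X)
    moreover have "(\<lambda>n. F' (sgn (X n - x))) \<longlonglongrightarrow> F' l"
      by (rule bounded_linear.tendsto[OF lin Xl])
    ultimately have "(\<lambda>n. (F (X n) - F x - F' (X n - x)) /\<^sub>R norm (X n - x) + F' (sgn (X n - x))) \<longlonglongrightarrow> 0 + F' l"
      by (rule tendsto_add)
    moreover have "(F (X n) - F x - F' (X n - x)) /\<^sub>R norm (X n - x) + F' (sgn (X n - x)) \<le> 0" for n
    proof -
      have "F' (sgn (X n - x)) = F' (X n - x) /\<^sub>R norm (X n - x)"
        unfolding sgn_div_norm by (rule linear_cmul) (rule bounded_linear.linear[OF lin])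
      then have "(F (X n) - F x - F' (X n - x)) /\<^sub>R norm (X n - x) + F' (sgn (X n - x))
        = F (X n) / norm (X n - x)"
        by (simp add: Fx field_simps)
      also have "\<dots> \<le> 0" using neg[of n] by (simp add: divide_nonpos_nonneg not_le)
      finally show ?thesis .
    qed
    ultimately have "F' l \<le> 0"
      by (intro LIMSEQ_le_const2[of _ "F' l"]) auto
    moreover have "0 < F' l"
      unfolding F'_def using l s k lp lq False y Fx
      by (intro directional_derivative_pos[of _ _ _ s]) (auto simp: F_def)
    ultimately show False by simp
  qed
qed

text \<open>The set where \<open>f\<close> is nonnegative is closed, so it has a last point; were
  that point before \<open>t\<close>, \<open>right\<close> would yield a later one.\<close>

lemma continuous_nonneg_propagates:
  fixes f :: "real \<Rightarrow> real"
  assumes cont: "continuous_on {s..t} f" and "s \<le> t" and start: "0 \<le> f s"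
    and right: "\<And>u. s \<le> u \<Longrightarrow> u < t \<Longrightarrow> 0 \<le> f u \<Longrightarrow> \<exists>d>0. \<forall>v\<in>{u<..t}. v < u + d \<longrightarrow> 0 \<le> f v"
  shows "0 \<le> f t"
proof (rule ccontr)
  assume neg: "\<not> ?thesis"
  define Z where "Z = {v\<in>{s..t}. 0 \<le> f v}"
  have "closed Z"
    using continuous_closed_preimage[OF cont, of "{0..}"]
    by (simp add: Z_def vimage_def Int_def)
  moreover have Z: "s \<in> Z" "bdd_above Z" using start \<open>s \<le> t\<close> by (auto simp: Z_def)
  ultimately have c: "Sup Z \<in> Z" using closed_contains_Sup by blast
  then have "s \<le> Sup Z" "Sup Z < t" "0 \<le> f (Sup Z)" using neg by (auto simp: Z_def less_le)
  from right[OF this] obtain d where d: "d > 0" "\<And>v. Sup Z < v \<Longrightarrow> v \<le> t \<Longrightarrow> v < Sup Z + d \<Longrightarrow> 0 \<le> f v"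
    by auto
  define v where "v = min t (Sup Z + d / 2)"
  have "Sup Z < v" "v \<le> t" "v < Sup Z + d" using d(1) \<open>Sup Z < t\<close> by (auto simp: v_def)
  moreover from this have "v \<in> Z" using d(2) \<open>s \<le> Sup Z\<close> by (auto simp: Z_def)
  then have "v \<le> Sup Z" using Z by (intro cSup_upper)
  ultimately show False by simp
qed

text \<open>Every \<open>u\<close> in \<open>{s..t}\<close> has both \<open>g r\<close> and
  \<open>g s\<close> in its past, so the ball condition at \<open>u\<close> constrains forward
  tangents against both. Nonnegativity of \<open>F\<close> then propagates from
  \<open>u = s\<close>, where \<open>F\<close> is 0, up to \<open>t\<close>.\<close>

lemma R_path_inner_ge:
  fixes g :: "real \<Rightarrow> real^2"
  assumes "R > 0" "N > 1" and path: "R_path R a b g" and inj: "inj_on g {a..b}"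
    and disk: "\<forall>t\<in>{a..b}. g ` {a..t} \<subseteq> cball (g t) (R / N)"
    and r: "a \<le> r" "r < s" "s \<le> t" "t \<le> b"
  shows "- (1 / (2 * N)) * (norm (g r - g t) * norm (g s - g t)) \<le> (g r - g t) \<bullet> (g s - g t)"
proof (rule ccontr)
  assume *: "\<not> ?thesis"
  define \<sigma> where "\<sigma> = 1 / (2 * N)"
  have \<sigma>: "0 < \<sigma>" "\<sigma> < 1 / 2" using \<open>N > 1\<close> by (simp_all add: \<sigma>_def)
  define n where "n = norm (g r - g t) * norm (g s - g t)"
  have "s \<noteq> t" using * by auto
  then have n: "0 < n"
    unfolding n_def using r inj_onD[OF inj, of r t] inj_onD[OF inj, of s t]
    by (intro mult_pos_pos) auto
  \<comment> \<open>The window for \<open>k\<close> is nonempty exactly because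
    \<open>\<sigma> < 1 / 2\<close>, that is, \<open>N > 1\<close>.\<close>
  have "2 * \<sigma>^2 - 1 < - \<sigma>"
  proof -
    have "0 < (1 - 2 * \<sigma>) * (1 + \<sigma>)" using \<sigma> by (intro mult_pos_pos) auto
    then show ?thesis by (simp add: power2_eq_square algebra_simps)
  qed
  moreover have "((g r - g t) \<bullet> (g s - g t)) / n < - \<sigma>"
    using * n by (simp add: \<sigma>_def n_def pos_divide_less_eq not_le)
  ultimately have "max (2 * \<sigma>^2 - 1) (((g r - g t) \<bullet> (g s - g t)) / n) < - \<sigma>"
    by simp
  \<comment> \<open>\<open>k\<close> is the cosine of the threshold angle: inside the window of the
    local lemma, yet above the cosine at \<open>t\<close>, so that
    \<open>F (g t) < 0\<close>.\<close>
  then obtain k where k: "max (2 * \<sigma>^2 - 1) (((g r - g t) \<bullet> (g s - g t)) / n) < k" "k < - \<sigma>"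
    using dense by blast
  define F where "F = (\<lambda>x. (g r - x) \<bullet> (g s - x) - k * (norm (g r - x) * norm (g s - x)))"
  have cont: "continuous_on {a..b} g" using path by (simp add: R_path_def)
  have "0 \<le> F (g t)"
  proof (rule continuous_nonneg_propagates[of s t "\<lambda>v. F (g v)"])
    show "continuous_on {s..t} (\<lambda>v. F (g v))"
      unfolding F_def using r by (intro continuous_intros continuous_on_subset[OF cont]) auto
    show "s \<le> t" "0 \<le> F (g s)" using r by (simp_all add: F_def)
    fix u assume u: "s \<le> u" "u < t" "0 \<le> F (g u)"
    have "\<exists>d>0. \<forall>v\<in>{u<..b}. v < u + d \<longrightarrow> 0 \<le> F (g v)"
      unfolding F_def
    proof (rule angle_function_right_nonneg[where s = \<sigma>])
      show "continuous_on {u..b} g" "inj_on g {u..b}" "u < b"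
        using u r cont inj by (auto intro: continuous_on_subset inj_on_subset)
      show "g r \<noteq> g u" using inj_onD[OF inj, of r u] u r by auto
      fix l assume l: "norm l = 1" "l \<in> tangent_cone (g ` {u..b}) (g u)"
      have "l \<bullet> (g w - g u) \<le> \<sigma> * norm (g w - g u)" if w: "a \<le> w" "w \<le> u" for w
      proof -
        have "g ` {a..u} \<inter> ball (g u + R *\<^sub>R l) R = {}"
          using path l u r unfolding R_path_def by (auto simp del: mem_ball)
        moreover have "g w \<in> g ` {a..u}" using w by simp
        ultimately have "g w \<notin> ball (g u + R *\<^sub>R l) R" by blast
        then have "2 * R * (l \<bullet> (g w - g u)) \<le> (norm (g w - g u))^2"
          using \<open>R > 0\<close> l by (intro inner_le_if_notin_ball)
        \<comment> \<open>Only one factor of the square is bounded by \<open>R / N\<close>; dividing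
          by \<open>2 * R\<close> then produces the constant \<open>1 / (2 * N)\<close>.\<close>
        also have "\<dots> \<le> norm (g w - g u) * (R / N)"
          using disk w u r unfolding power2_eq_square
          by (intro mult_left_mono) (auto simp: dist_norm norm_minus_commute image_subset_iff)
        also have "\<dots> = 2 * R * (\<sigma> * norm (g w - g u))"
          by (simp add: \<sigma>_def)
        finally show ?thesis using \<open>R > 0\<close> by simp
      qed
      then show "l \<bullet> (g r - g u) \<le> \<sigma> * norm (g r - g u) \<and> l \<bullet> (g s - g u) \<le> \<sigma> * norm (g s - g u)"
        using u r by auto
    qed (use \<sigma> k u in \<open>auto simp: F_def\<close>)
    then show "\<exists>d>0. \<forall>v\<in>{u<..t}. v < u + d \<longrightarrow> 0 \<le> F (g v)"
      using \<open>t \<le> b\<close> by (meson greaterThanAtMost_iff order_trans)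
  qed
  moreover have "F (g t) < 0"
    using k n by (simp add: F_def n_def pos_divide_less_eq)
  ultimately show False by simp
qed

section \<open>Pairwise close directions lie in one arc\<close>

text \<open>\<open>f\<close> is \<open>e\<close> turned by a right angle, so this is Parseval's
  identity in the orthonormal basis of \<open>e\<close> and \<open>f\<close>.\<close>

lemma inner_2_orthonormal:
  fixes e :: "real^2"
  assumes "norm e = 1"
  defines "f \<equiv> vector [- e $ 2, e $ 1] :: real^2"
  shows "u \<bullet> v = (u \<bullet> e) * (v \<bullet> e) + (u \<bullet> f) * (v \<bullet> f)"
proof -
  have e: "e $ 1 * e $ 1 + e $ 2 * e $ 2 = 1"
    using assms(1) by (simp add: norm_eq_1 inner_vec_def sum_2)
  have "(u \<bullet> e) * (v \<bullet> e) + (u \<bullet> f) * (v \<bullet> f) = (u \<bullet> v) * (e $ 1 * e $ 1 + e $ 2 * e $ 2)"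
    by (simp add: inner_vec_def sum_2 f_def algebra_simps)
  then show ?thesis by (simp add: e)
qed

text \<open>If \<open>\<gamma> + \<omega>\<close> exceeds \<open>pi\<close>, reflecting it gives
  \<open>\<gamma> \<ge> 2 * pi - 3 * \<omega> > pi\<close>, which is impossible. This excludes three
  directions surrounding a point.\<close>

lemma cos_add_ge_cos_double_imp_le:
  assumes "0 \<le> \<omega>" "\<omega> < pi / 3" "0 \<le> \<gamma>" "\<gamma> \<le> pi" "cos (2 * \<omega>) \<le> cos (\<gamma> + \<omega>)"
  shows "\<gamma> \<le> \<omega>"
proof (cases "\<gamma> + \<omega> \<le> pi")
  case True
  then have "\<gamma> + \<omega> \<le> 2 * \<omega>"
    using assms by (subst cos_mono_le_eq[symmetric]) auto
  then show ?thesis by simp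
next
  case False
  have "cos (\<gamma> + \<omega>) = cos (2 * pi - (\<gamma> + \<omega>))" by (simp add: cos_diff)
  then have "2 * pi - (\<gamma> + \<omega>) \<le> 2 * \<omega>"
    using assms False by (subst cos_mono_le_eq[symmetric]) auto
  then show ?thesis using assms False by linarith
qed

text \<open>A pair \<open>p\<close>, \<open>q\<close> in \<open>K\<close> with the widest angle
  \<open>2 * \<omega>\<close> exists by compactness, and \<open>e\<close> bisects it. A direction at
  angle \<open>\<gamma>\<close> from \<open>e\<close> has an inner product
  \<open>cos (\<gamma> + \<omega>)\<close> with \<open>p\<close> or \<open>q\<close>; maximality of
  the angle forces \<open>\<gamma> \<le> \<omega>\<close>.\<close>

lemma unit_vectors_in_half_angle_cone:
  fixes K :: "(real^2) set"
  assumes K: "compact K" "K \<noteq> {}" "K \<subseteq> sphere 0 1" and \<sigma>: "\<sigma> < 1 / 2"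
    and pair: "\<And>p q. p \<in> K \<Longrightarrow> q \<in> K \<Longrightarrow> - \<sigma> \<le> p \<bullet> q"
  obtains e where "norm e = 1" "\<And>r. r \<in> K \<Longrightarrow> sqrt ((1 - \<sigma>) / 2) \<le> r \<bullet> e"
proof -
  have "compact (K \<times> K)" "K \<times> K \<noteq> {}" "continuous_on (K \<times> K) (\<lambda>w. fst w \<bullet> snd w)"
    using K by (auto intro!: compact_Times continuous_intros)
  from continuous_attains_inf[OF this] obtain w where w: "w \<in> K \<times> K"
    and w_min: "\<And>w'. w' \<in> K \<times> K \<Longrightarrow> fst w \<bullet> snd w \<le> fst w' \<bullet> snd w'"
    by blast
  define p q where "p = fst w" and "q = snd w"
  have pq: "p \<in> K" "q \<in> K" using w by (auto simp: p_def q_def)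
  have min: "p \<bullet> q \<le> u \<bullet> v" if "u \<in> K" "v \<in> K" for u v
    using w_min[of "(u, v)"] that by (simp add: p_def q_def)
  have np: "p \<bullet> p = 1" "q \<bullet> q = 1" using pq K by (auto simp: dot_square_norm)
  have m: "- 1 / 2 < p \<bullet> q" "- \<sigma> \<le> p \<bullet> q" using pair[OF pq] \<sigma> by auto
  have npq: "(norm (p + q))^2 = 2 * (1 + p \<bullet> q)"
    by (simp add: power2_norm_eq_inner inner_add np inner_commute)
  then have pq0: "p + q \<noteq> 0" using m by auto
  define e where "e = sgn (p + q)"
  have e: "norm e = 1" using pq0 by (simp add: e_def norm_sgn)
  define f where "f = (vector [- e $ 2, e $ 1] :: real^2)"
  note orth = inner_2_orthonormal[OF e, folded f_def]
  have *: "norm (p + q) * (p \<bullet> e) = 1 + p \<bullet> q" "norm (p + q) * (q \<bullet> e) = 1 + p \<bullet> q"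
  proof -
    have "norm (v::real^2) *\<^sub>R sgn v = v" for v
      by (cases "v = 0") (simp_all add: sgn_div_norm)
    then have "norm (p + q) *\<^sub>R e = p + q" by (simp only: e_def)
    then have "norm (p + q) * (v \<bullet> e) = v \<bullet> (p + q)" for v
      by (metis inner_scaleR_right)
    then show "norm (p + q) * (p \<bullet> e) = 1 + p \<bullet> q" "norm (p + q) * (q \<bullet> e) = 1 + p \<bullet> q"
      by (simp_all add: inner_add_right np inner_commute[of q p])
  qed
  define \<tau> where "\<tau> = p \<bullet> e"
  have \<tau>: "q \<bullet> e = \<tau>" "norm (p + q) * \<tau> = 1 + p \<bullet> q"
  proof -
    have "norm (p + q) \<noteq> 0" using pq0 by (metis norm_eq_zero)
    moreover have "norm (p + q) * (q \<bullet> e) = norm (p + q) * \<tau>" by (simp only: * \<tau>_def)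
    ultimately show "q \<bullet> e = \<tau>" by (rule mult_left_cancel[THEN iffD1])
    show "norm (p + q) * \<tau> = 1 + p \<bullet> q" using * by (simp add: \<tau>_def)
  qed
  have tau0: "\<tau> > 0"
  proof (rule zero_less_mult_pos)
    show "0 < norm (p + q) * \<tau>" using \<tau>(2) m by linarith
    show "0 < norm (p + q)" using pq0 by (rule zero_less_norm_iff[THEN iffD2])
  qed
  have "2 * (1 + p \<bullet> q) * \<tau>^2 = (1 + p \<bullet> q)^2"
    unfolding npq[symmetric] power_mult_distrib[symmetric] \<tau>(2) ..
  then have "(1 + p \<bullet> q) * (2 * \<tau>^2) = (1 + p \<bullet> q) * (1 + p \<bullet> q)"
    by (simp add: power2_eq_square mult_ac)
  moreover have "1 + p \<bullet> q \<noteq> 0" using m by linarith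
  ultimately have tau2: "2 * \<tau>^2 = 1 + p \<bullet> q" by (simp only: mult_cancel_left) simp
  \<comment> \<open>This is \<open>\<omega> < pi / 3\<close>; it comes from
    \<open>p \<bullet> q > - 1 / 2\<close>, hence from \<open>\<sigma> < 1 / 2\<close>.\<close>
  have tau_half: "1 / 2 < \<tau>"
    using tau2 m tau0 power_less_imp_less_base[of "1/2" 2 \<tau>] by (simp add: power_divide)
  define \<omega> where "\<omega> = arccos \<tau>"
  have tau1: "\<tau> \<le> 1" using e pq K norm_cauchy_schwarz[of p e] by (auto simp: \<tau>_def)
  have om: "cos \<omega> = \<tau>" "0 \<le> \<omega>" "\<omega> < pi / 3"
  proof -
    show "cos \<omega> = \<tau>" "0 \<le> \<omega>" using tau0 tau1 by (auto simp: \<omega>_def cos_arccos arccos_lbound)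
    have "arccos \<tau> < arccos (1 / 2)" using tau_half tau1 by (intro arccos_less_arccos) auto
    also have "arccos (1 / 2) = pi / 3"
      using arccos_cos[of "pi/3"] by (simp add: cos_60)
    finally show "\<omega> < pi / 3" by (simp add: \<omega>_def)
  qed
  define s where "s = sin \<omega>"
  have s: "s \<ge> 0" "s^2 = 1 - \<tau>^2"
    using om by (auto simp: s_def sin_squared_eq intro!: sin_ge_zero)
  have pf: "(p \<bullet> f)^2 = s^2" "(q \<bullet> f)^2 = s^2"
    using orth[of p p] orth[of q q] np \<tau> unfolding s(2) by (simp_all add: \<tau>_def power2_eq_square)
  \<comment> \<open>\<open>p\<close> and \<open>q\<close> are mirror images in the line through
    \<open>e\<close>.\<close>
  have "(p + q) \<bullet> f = 0"
  proof -
    have "e \<bullet> f = 0" by (simp add: f_def inner_vec_def sum_2)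
    then show ?thesis using pq0 by (simp add: e_def sgn_div_norm)
  qed
  then have qf: "q \<bullet> f = - (p \<bullet> f)" by (simp add: inner_add)
  have "sqrt ((1 - \<sigma>) / 2) \<le> r \<bullet> e" if r: "r \<in> K" for r
  proof -
    have nr: "r \<bullet> r = 1" using r K by (auto simp: dot_square_norm)
    define c where "c = r \<bullet> e"
    define d where "d = \<bar>r \<bullet> f\<bar>"
    have cd: "c^2 + d^2 = 1" using orth[of r r] nr by (simp add: c_def d_def power2_eq_square)
    \<comment> \<open>Minimality is applied to \<open>r\<close> with \<open>p\<close> and to
      \<open>r\<close> with \<open>q\<close>. Their \<open>f\<close> components are opposite, so one
      of the two bounds carries the minus sign, whatever side of \<open>e\<close> contains
      \<open>r\<close>.\<close>
    have "p \<bullet> q \<le> c * \<tau> - d * s"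
    proof -
      have "p \<bullet> q \<le> c * \<tau> + (r \<bullet> f) * (p \<bullet> f)" "p \<bullet> q \<le> c * \<tau> - (r \<bullet> f) * (p \<bullet> f)"
        using min[OF r pq(1)] min[OF r pq(2)] orth[of r p] orth[of r q] \<tau> qf
        by (simp_all add: c_def \<tau>_def)
      then have "p \<bullet> q \<le> c * \<tau> - \<bar>(r \<bullet> f) * (p \<bullet> f)\<bar>" by (auto simp: abs_if)
      moreover have "\<bar>p \<bullet> f\<bar> = s"
        using arg_cong[OF pf(1), of sqrt] s(1) by (simp only: real_sqrt_abs abs_of_nonneg)
      ultimately show ?thesis by (simp add: abs_mult d_def)
    qed
    moreover have "p \<bullet> q = cos (2 * \<omega>)" using tau2 om(1) by (simp add: cos_double_cos)
    ultimately have cos_le: "cos (2 * \<omega>) \<le> c * \<tau> - d * s" by simp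
    define \<gamma> where "\<gamma> = arccos c"
    have c1: "\<bar>c\<bar> \<le> 1"
    proof -
      have "c^2 \<le> 1" using cd zero_le_power2[of d] by linarith
      then show ?thesis using abs_square_le_1 by blast
    qed
    have g: "cos \<gamma> = c" "0 \<le> \<gamma>" "\<gamma> \<le> pi"
      using c1 by (auto simp: \<gamma>_def cos_arccos arccos_lbound arccos_ubound abs_le_iff)
    have "sin \<gamma> = d"
    proof -
      have "(sin \<gamma>)^2 = d^2" using cd g by (simp add: sin_squared_eq)
      moreover have "0 \<le> sin \<gamma>" "0 \<le> d" using g by (auto simp: sin_ge_zero d_def)
      ultimately show ?thesis by simp
    qed
    then have "c * \<tau> - d * s = cos (\<gamma> + \<omega>)" using g(1) om(1) by (simp add: cos_add s_def mult_ac)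
    then have "\<gamma> \<le> \<omega>"
      using cos_add_ge_cos_double_imp_le[OF om(2,3) g(2,3)] cos_le by simp
    then have "\<tau> \<le> c" using cos_mono_le_eq[of \<omega> \<gamma>] om g by simp
    moreover have "sqrt ((1 - \<sigma>) / 2) \<le> \<tau>"
    proof (rule real_le_lsqrt)
      show "(1 - \<sigma>) / 2 \<le> \<tau>^2" using tau2 m(2) by (simp add: field_simps)
    qed (use tau0 in linarith)
    ultimately show ?thesis by (simp add: c_def)
  qed
  then show thesis using that e by blast
qed


section \<open>Arc length and tangent cones of convex hulls\<close>

lemma circle_point_inner: "circle_point \<theta> \<bullet> circle_point \<phi> = cos (\<theta> - \<phi>)"
  by (simp add: circle_point_def inner_vec_def sum_2 cos_diff)

lemma unit_vector_eq_circle_point: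
  assumes "norm e = 1"
  obtains \<theta> where "0 \<le> \<theta>" "\<theta> < 2 * pi" "e = circle_point \<theta>"
proof -
  have "(e $ 1)^2 + (e $ 2)^2 = 1"
    using assms by (simp add: norm_eq_1 inner_vec_def sum_2 power2_eq_square)
  then obtain \<theta> where "0 \<le> \<theta>" "\<theta> < 2 * pi" "e $ 1 = cos \<theta>" "e $ 2 = sin \<theta>"
    using sincos_total_2pi by metis
  then show thesis
    by (intro that[of \<theta>]) (auto simp: circle_point_def vec_eq_iff forall_2)
qed

lemma measure_arc_le:
  assumes S: "S \<in> sets arc_length_measure" and e: "norm e = 1" and \<beta>: "0 \<le> \<beta>" "\<beta> \<le> pi"
    and sub: "\<And>v. v \<in> S \<Longrightarrow> cos \<beta> \<le> v \<bullet> e"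
  shows "measure arc_length_measure S \<le> 2 * \<beta>"
proof -
  obtain \<phi> where \<phi>: "0 \<le> \<phi>" "\<phi> < 2 * pi" "e = circle_point \<phi>"
    using unit_vector_eq_circle_point[OF e] .
  define T where "T = circle_point -` S \<inter> {0..<2*pi}"
  have S': "S \<in> sets (restrict_space borel (sphere 0 1))"
    using S by (simp add: arc_length_measure_def)
  have "circle_point -` S \<inter> space (restrict_space lborel {0..<2*pi}) = T"
    by (simp add: T_def space_restrict_space)
  then have "measure arc_length_measure S = measure (restrict_space lborel {0..<2*pi}) T"
    and T: "T \<in> sets (restrict_space lborel {0..<2*pi})"
    using measure_distr[OF circle_point_measurable S'] measurable_sets[OF circle_point_measurable S']
    by (simp_all add: arc_length_measure_def)
  moreover have "measure (restrict_space lborel {0..<2*pi}) T = measure lborel T"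
    by (rule measure_restrict_space) (auto simp: T_def)
  moreover have "T \<in> sets lborel"
    using T by (simp add: sets_restrict_space_iff)
  moreover
  \<comment> \<open>\<open>A\<close> is the parameter interval of radius \<open>\<beta>\<close>
    about \<open>\<phi>\<close>, cut to \<open>[0, 2 * pi]\<close>; \<open>B\<close> and
    \<open>C\<close> are the pieces cut off below and above, shifted by a period. The lengths add up
    to \<open>2 * \<beta>\<close>.\<close>
  define A B C where "A = {max 0 (\<phi> - \<beta>)..min (2 * pi) (\<phi> + \<beta>)}"
    and "B = {\<phi> + 2 * pi - \<beta>..2 * pi}" and "C = {0..\<phi> + \<beta> - 2 * pi}"
  have "T \<subseteq> A \<union> B \<union> C"
  proof
    fix \<theta> assume "\<theta> \<in> T"
    then have \<theta>: "0 \<le> \<theta>" "\<theta> < 2 * pi" and c: "cos \<beta> \<le> cos \<bar>\<theta> - \<phi>\<bar>"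
      using sub[of "circle_point \<theta>"] by (auto simp: T_def \<phi> circle_point_inner)
    have "\<bar>\<theta> - \<phi>\<bar> \<le> \<beta> \<or> 2 * pi - \<bar>\<theta> - \<phi>\<bar> \<le> \<beta>"
    proof (cases "\<bar>\<theta> - \<phi>\<bar> \<le> pi")
      case True
      then show ?thesis using c \<beta> cos_mono_le_eq[of "\<beta>" "\<bar>\<theta> - \<phi>\<bar>"] by auto
    next
      case False
      have "cos \<bar>\<theta> - \<phi>\<bar> = cos (2 * pi - \<bar>\<theta> - \<phi>\<bar>)" by (simp only: cos_diff) simp
      then show ?thesis
        using c \<beta> False \<theta> \<phi> cos_mono_le_eq[of "\<beta>" "2 * pi - \<bar>\<theta> - \<phi>\<bar>"] by auto
    qed
    then show "\<theta> \<in> A \<union> B \<union> C" using \<theta> \<phi> by (auto simp: A_def B_def C_def abs_if split: if_splits)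
  qed
  ultimately have "measure arc_length_measure S \<le> measure lborel (A \<union> B \<union> C)"
    by (auto simp: A_def B_def C_def intro!: measure_mono_fmeasurable fmeasurable_compact compact_Un)
  also have "\<dots> \<le> measure lborel A + measure lborel B + measure lborel C"
    by (intro order_trans[OF measure_Un_le] add_mono order_refl) (auto simp: A_def B_def C_def)
  also have "\<dots> = 2 * \<beta>"
    using \<phi> \<beta> by (auto simp: A_def B_def C_def min_def max_def)
  finally show ?thesis .
qed

text \<open>The circular cone \<open>C\<close> about \<open>e\<close> is closed, stable under
  positive scaling and, as \<open>0 \<le> c\<close>, convex. Its translate to \<open>x\<close>
  therefore contains the hull of \<open>A\<close>, and \<open>C\<close> contains all limits of
  scaled secants.\<close>

lemma tangent_cone_subset_cone:
  assumes "norm e = 1" and "\<And>y. y \<in> A \<Longrightarrow> c * norm (y - x) \<le> (y - x) \<bullet> e" and "0 \<le> c"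
    and v: "v \<in> tangent_cone (convex hull A) x"
  shows "c * norm v \<le> v \<bullet> e"
proof -
  define C where "C = {v. c * norm v \<le> v \<bullet> e}"
  have scale: "r *\<^sub>R w \<in> C" if "w \<in> C" "r > 0" for w r
    using that by (simp add: C_def)
  have closed: "closed C"
    unfolding C_def by (intro closed_Collect_le continuous_intros)
  have "convex C"
    unfolding C_def convex_def
  proof safe
    fix p q and u w :: real
    assume h: "c * norm p \<le> p \<bullet> e" "c * norm q \<le> q \<bullet> e" "0 \<le> u" "0 \<le> w"
    have "c * norm (u *\<^sub>R p + w *\<^sub>R q) \<le> c * (u * norm p + w * norm q)"
      using \<open>0 \<le> c\<close> h norm_triangle_ineq[of "u *\<^sub>R p" "w *\<^sub>R q"] by (intro mult_left_mono) auto
    also have "\<dots> = u * (c * norm p) + w * (c * norm q)" by (simp add: algebra_simps)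
    also have "\<dots> \<le> u * (p \<bullet> e) + w * (q \<bullet> e)"
      using h by (intro add_mono mult_left_mono) auto
    finally show "c * norm (u *\<^sub>R p + w *\<^sub>R q) \<le> (u *\<^sub>R p + w *\<^sub>R q) \<bullet> e"
      by (simp add: inner_add)
  qed
  then have "convex ((\<lambda>w. x + w) ` C)" by (rule convex_translation)
  moreover have "A \<subseteq> (\<lambda>w. x + w) ` C"
  proof
    fix y assume "y \<in> A"
    then show "y \<in> (\<lambda>w. x + w) ` C"
      using assms(2) by (intro image_eqI[of _ _ "y - x"]) (auto simp: C_def)
  qed
  ultimately have hull: "convex hull A \<subseteq> (\<lambda>w. x + w) ` C" by (rule hull_minimal[rotated])
  have "v \<in> closure C"
    unfolding closure_approachable
  proof safe
    fix \<epsilon> :: real assume "\<epsilon> > 0"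
    then obtain y r where yr: "y \<in> convex hull A" "r > 0" "norm (r *\<^sub>R (y - x) - v) < \<epsilon>"
      using v unfolding tangent_cone_def by blast
    then have "y - x \<in> C" using hull by auto
    then show "\<exists>w\<in>C. dist w v < \<epsilon>"
      using yr scale by (auto simp: dist_norm)
  qed
  then show ?thesis using closed by (simp add: C_def)
qed

lemma closure_inner_ge:
  fixes D :: "'a::real_inner set"
  assumes "\<And>p q. p \<in> D \<Longrightarrow> q \<in> D \<Longrightarrow> c \<le> p \<bullet> q" and "p \<in> closure D" "q \<in> closure D"
  shows "c \<le> p \<bullet> q"
proof -
  have "closure D \<subseteq> {q. c \<le> p \<bullet> q}" if "p \<in> D" for p
    using assms(1) that by (intro closure_minimal closed_Collect_le continuous_intros) auto
  then have "closure D \<subseteq> {p. c \<le> p \<bullet> q}" if "q \<in> closure D" for q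
    using that by (intro closure_minimal closed_Collect_le continuous_intros) auto
  then show ?thesis using assms(2,3) by auto
qed

lemma measure_tangent_cone_hull_le:
  fixes A :: "(real^2) set"
  assumes \<sigma>: "0 \<le> \<sigma>" "\<sigma> < 1 / 2"
    and pair: "\<And>y z. y \<in> A \<Longrightarrow> z \<in> A \<Longrightarrow>
      - \<sigma> * (norm (y - x) * norm (z - x)) \<le> (y - x) \<bullet> (z - x)"
  shows "measure arc_length_measure (tangent_cone (convex hull A) x \<inter> sphere 0 1)
    \<le> pi / 2 + arcsin \<sigma>"
proof -
  \<comment> \<open>Half the claimed opening: \<open>cos (2 * \<beta>) = - \<sigma>\<close>, so
    \<open>cos \<beta>\<close> matches the bound \<open>sqrt ((1 - \<sigma>) / 2)\<close> for the
    bisector.\<close>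
  define \<beta> where "\<beta> = (pi / 2 + arcsin \<sigma>) / 2"
  have "0 \<le> arcsin \<sigma>" "arcsin \<sigma> \<le> pi / 2"
    using \<sigma> arcsin_ubound[of \<sigma>] by (auto intro!: arcsin_nonneg)
  then have \<beta>: "0 \<le> \<beta>" "\<beta> \<le> pi / 2" by (simp_all add: \<beta>_def)
  have cos: "cos \<beta> \<le> sqrt ((1 - \<sigma>) / 2)"
  proof (rule real_le_rsqrt)
    have "2 * \<beta> = pi / 2 + arcsin \<sigma>" by (simp add: \<beta>_def)
    then have "cos (2 * \<beta>) = - \<sigma>" using \<sigma> by (simp add: cos_add)
    then show "(cos \<beta>)^2 \<le> (1 - \<sigma>) / 2" by (simp add: cos_double_cos)
  qed
  define D where "D = (\<lambda>y. sgn (y - x)) ` (A - {x})"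
  have Dpair: "- \<sigma> \<le> p \<bullet> q" if pq: "p \<in> D" "q \<in> D" for p q
  proof -
    obtain y z where yz: "y \<in> A" "z \<in> A" "y \<noteq> x" "z \<noteq> x" "p = sgn (y - x)" "q = sgn (z - x)"
      using pq by (auto simp: D_def)
    have "p \<bullet> q = ((y - x) \<bullet> (z - x)) / (norm (y - x) * norm (z - x))"
      by (simp add: yz sgn_div_norm divide_inverse)
    then show ?thesis using pair[OF yz(1,2)] yz(3,4) by (simp add: pos_le_divide_eq)
  qed
  obtain e where e: "norm e = 1" "\<And>p. p \<in> D \<Longrightarrow> cos \<beta> \<le> p \<bullet> e"
  proof (cases "D = {}")
    case True
    \<comment> \<open>Here \<open>A\<close> is contained in \<open>{x}\<close>, so any unit vector
      serves.\<close>
    then show thesis using that[of "axis 1 1"] by auto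
  next
    case False
    \<comment> \<open>The closure of \<open>D\<close> is compact, so that a widest pair exists; the
      pairwise bound passes to it by continuity.\<close>
    have "D \<subseteq> sphere 0 1" by (auto simp: D_def norm_sgn split: if_splits)
    then have "closure D \<subseteq> sphere 0 1" by (intro closure_minimal) auto
    moreover from this have "compact (closure D)"
      using compact_eq_bounded_closed bounded_subset[OF bounded_sphere] closed_closure by blast
    moreover have "closure D \<noteq> {}" using False by simp
    ultimately obtain e where "norm e = 1" "\<And>p. p \<in> closure D \<Longrightarrow> sqrt ((1 - \<sigma>) / 2) \<le> p \<bullet> e"
      using unit_vectors_in_half_angle_cone[of "closure D" \<sigma>] \<sigma> closure_inner_ge[OF Dpair] by metis
    then show thesis using that cos closure_subset[of D] by (meson order_trans subsetD)
  qed
  have cone: "cos \<beta> * norm (y - x) \<le> (y - x) \<bullet> e" if "y \<in> A" for y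
  proof (cases "y = x")
    case False
    then have "cos \<beta> \<le> sgn (y - x) \<bullet> e" using that by (intro e) (auto simp: D_def)
    moreover have "sgn (y - x) \<bullet> e = ((y - x) \<bullet> e) / norm (y - x)"
      by (simp add: sgn_div_norm divide_inverse_commute)
    ultimately show ?thesis using False by (simp add: pos_le_divide_eq)
  qed simp
  have "measure arc_length_measure (tangent_cone (convex hull A) x \<inter> sphere 0 1) \<le> 2 * \<beta>"
  proof (rule measure_arc_le[OF tangent_cone_sphere_measurable e(1)])
    fix v assume "v \<in> tangent_cone (convex hull A) x \<inter> sphere 0 1"
    then show "cos \<beta> \<le> v \<bullet> e"
      using tangent_cone_subset_cone[OF e(1) cone] cos_ge_zero[of \<beta>] \<beta> by fastforce
  qed (use \<beta> in auto)
  then show ?thesis by (simp add: \<beta>_def)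
qed

theorem theorem4p4:
  fixes g :: "real \<Rightarrow> real^2" and a b R N :: real
  assumes "R > 0" and "N > 1"
    and "R_path R a b g" and "inj_on g {a..b}"
    and "\<forall>t\<in>{a..b}. g ` {a..t} \<subseteq> cball (g t) (R / N)"
  shows "\<forall>t\<in>{a..b}.
    measure arc_length_measure (tangent_cone (convex hull (g ` {a..t})) (g t) \<inter> sphere 0 1)
      \<le> pi / 2 + 2 * arcsin (1 / (2 * N))"
proof
  fix t assume t: "t \<in> {a..b}"
  define \<sigma> where "\<sigma> = 1 / (2 * N)"
  have \<sigma>: "0 \<le> \<sigma>" "\<sigma> < 1 / 2" using \<open>N > 1\<close> by (simp_all add: \<sigma>_def)
  have ordered: "- \<sigma> * (norm (g r - g t) * norm (g s - g t)) \<le> (g r - g t) \<bullet> (g s - g t)"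
    if "a \<le> r" "r < s" "s \<le> t" for r s
    using R_path_inner_ge[OF assms] that t by (simp add: \<sigma>_def)
  have "- \<sigma> * (norm (g r - g t) * norm (g s - g t)) \<le> (g r - g t) \<bullet> (g s - g t)"
    if "r \<in> {a..t}" "s \<in> {a..t}" for r s
  \<comment> \<open>The path estimate wants the earlier parameter first. Symmetry of the inner
    product covers the reversed order, and for \<open>r = s\<close> the right side is a
    square.\<close>
  proof (cases r s rule: linorder_cases)
    case equal
    have "- \<sigma> * (norm (g s - g t) * norm (g s - g t)) \<le> 0" using \<sigma> by simp
    also have "0 \<le> (g s - g t) \<bullet> (g s - g t)" by simp
    finally show ?thesis using equal by simp
  qed (use that ordered[of r s] ordered[of s r] in \<open>auto simp: inner_commute mult.commute\<close>)
  then have "measure arc_length_measure (tangent_cone (convex hull (g ` {a..t})) (g t) \<inter> sphere 0 1)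
      \<le> pi / 2 + arcsin \<sigma>"
    using \<sigma> by (intro measure_tangent_cone_hull_le) auto
  also have "\<dots> \<le> pi / 2 + 2 * arcsin \<sigma>"
    using \<sigma> arcsin_nonneg[of \<sigma>] by simp
  finally show "measure arc_length_measure (tangent_cone (convex hull (g ` {a..t})) (g t) \<inter> sphere 0 1)
      \<le> pi / 2 + 2 * arcsin (1 / (2 * N))"
    by (simp add: \<sigma>_def)
qed

end
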